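(* Let $N \geq 1$ be an odd integer, let $G=\{1,\dots,N\}$, and let $\mathbf{M_N}$ be the associated $N\times\binom{N}{R}$ coefficient matrix, $R=\frac{N+1}{2}$. For any nonempty proper subsets $G_1, G_2 \subset G$, we have $\overrightarrow{G_1}=\overrightarrow{G_2}$ if and only if $G_1=G_2$.
   Context: Let $N$ be an odd positive integer, $G=\{1,\dots,N\}$ (the set of stations) and $R=\frac{N+1}{2}$. The coefficient matrix $\mathbf{M_N}$ has size $N\times\binom{N}{R}$, with rows indexed by $G$ and entries in $\{+1,-1\}$; its columns are, without repetition, all the vectors in $\{+1,-1\}^N$ having exactly $R$ entries equal to $+1$ and exactly $R-1$ entries equal to $-1$ (in some fixed order). For $G_0\subseteq G$ and a column index $c\in\{1,\dots,\binom{N}{R}\}$, define $F(G_0,c)=\sum_{r\in G_0}\mathbf{M_N}(r,c)$. Define the vector $\overrightarrow{G_0}\in\{0,1\}^{\binom{N}{R}}$ by $\overrightarrow{G_0}(c)=1$ if $F(G_0,c)\geq 1$ and $\overrightarrow{G_0}(c)=0$ if $F(G_0,c)<1$, for $c=1,\dots,\binom{N}{R}$. (This is the bitstream decoded by majority rule, with ties decoded as $0$, when exactly the stations in $G_0$ transmit their rows simultaneously.) *)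

theory Defs
  imports Main "HOL-Library.FuncSet"
begin

definition stations :: "nat \<Rightarrow> nat set" where
  "stations N = {1..N}"

definition plus_count :: "nat \<Rightarrow> nat" where
  "plus_count N = (N + 1) div 2"

text \<open>Column numbers of the matrix, counted from 1.\<close>

definition col_indices :: "nat \<Rightarrow> nat set" where
  "col_indices N = {1..N choose plus_count N}"

definition balanced_vectors :: "nat \<Rightarrow> (nat \<Rightarrow> int) set" where
  "balanced_vectors N =
    {v \<in> stations N \<rightarrow>\<^sub>E {1, -1}.
       card {r \<in> stations N. v r = 1} = plus_count N \<and>
       card {r \<in> stations N. v r = -1} = plus_count N - 1}"

text \<open>
  The order of the columns is arbitrary, so being a coefficient matrix is a predicate on
  \<^term>\<open>M\<close>: its column map is a bijection onto the admissible vectors, i.e. the columns are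
  all of these vectors, without repetition. Entries of \<^term>\<open>M\<close> outside the index range are
  unconstrained and never used.
\<close>

definition coefficient_matrix :: "nat \<Rightarrow> (nat \<Rightarrow> nat \<Rightarrow> int) \<Rightarrow> bool" where
  "coefficient_matrix N M \<longleftrightarrow>
     bij_betw (\<lambda>c. \<lambda>r\<in>stations N. M r c) (col_indices N) (balanced_vectors N)"

definition superposition :: "(nat \<Rightarrow> nat \<Rightarrow> int) \<Rightarrow> nat set \<Rightarrow> nat \<Rightarrow> int" where
  "superposition M G0 c = (\<Sum>r\<in>G0. M r c)"

text \<open>
  A 0/1 vector is a function on the column numbers that is \<^term>\<open>undefined\<close> elsewhere, so
  equality of functions is equality of vectors.
\<close>

definition decoded :: "nat \<Rightarrow> (nat \<Rightarrow> nat \<Rightarrow> int) \<Rightarrow> nat set \<Rightarrow> (nat \<Rightarrow> nat)" where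
  "decoded N M G0 = (\<lambda>c\<in>col_indices N. if superposition M G0 c \<ge> 1 then 1 else 0)"

text \<open>For odd \<^term>\<open>N\<close> the number of admissible vectors is the number of columns, so a
  coefficient matrix exists.\<close>

lemma card_balanced_vectors:
  assumes "odd N"
  shows "card (balanced_vectors N) = N choose plus_count N"
proof -
  let ?R = "plus_count N"
  let ?f = "\<lambda>A. \<lambda>r\<in>stations N. if r \<in> A then 1 else (-1::int)"
  let ?S = "{A. A \<subseteq> stations N \<and> card A = ?R}"
  have fin: "finite (stations N)" and cardN: "card (stations N) = N"
    by (simp_all add: stations_def)
  have R: "N - ?R = ?R - 1" using assms by (auto simp: plus_count_def elim!: oddE)
  have "bij_betw ?f ?S (balanced_vectors N)"
  proof (rule bij_betw_byWitness[where f' = "\<lambda>v. {r \<in> stations N. v r = 1}"])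
    show "\<forall>A\<in>?S. {r \<in> stations N. ?f A r = 1} = A" by (auto split: if_splits)
    show "\<forall>v\<in>balanced_vectors N. ?f {r \<in> stations N. v r = 1} = v"
      by (auto simp: balanced_vectors_def PiE_def Pi_def extensional_def fun_eq_iff)
    show "?f ` ?S \<subseteq> balanced_vectors N"
    proof clarify
      fix A assume A: "A \<subseteq> stations N" "card A = ?R"
      have "{r \<in> stations N. ?f A r = 1} = A" using A(1) by (auto split: if_splits)
      moreover have "{r \<in> stations N. ?f A r = -1} = stations N - A"
        by (auto split: if_splits)
      moreover have "card (stations N - A) = ?R - 1"
        using A fin cardN R by (simp add: card_Diff_subset finite_subset)
      ultimately show "?f A \<in> balanced_vectors N"
        using A(2) unfolding balanced_vectors_def by auto
    qed
    show "(\<lambda>v. {r \<in> stations N. v r = 1}) ` balanced_vectors N \<subseteq> ?S"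
      by (auto simp: balanced_vectors_def)
  qed
  then have "card (balanced_vectors N) = card ?S" by (simp add: bij_betw_same_card)
  then show ?thesis using n_subsets[OF fin] cardN by simp
qed

lemma coefficient_matrix_exists:
  assumes "odd N"
  shows "\<exists>M. coefficient_matrix N M"
proof -
  have "finite (balanced_vectors N)"
    unfolding balanced_vectors_def stations_def
    by (rule finite_subset[of _ "{1..N} \<rightarrow>\<^sub>E {1, -1}"]) (auto intro: finite_PiE)
  then obtain g where g: "bij_betw g (col_indices N) (balanced_vectors N)"
    using finite_same_card_bij[of "col_indices N" "balanced_vectors N"]
      card_balanced_vectors[OF assms] by (auto simp: col_indices_def)
  have "coefficient_matrix N (\<lambda>r c. g c r)"
    unfolding coefficient_matrix_def
  proof (rule iffD1[OF bij_betw_cong g])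
    fix c assume "c \<in> col_indices N"
    then have "g c \<in> balanced_vectors N" using g by (auto simp: bij_betw_def)
    then show "g c = (\<lambda>r\<in>stations N. g c r)"
      by (auto simp: balanced_vectors_def PiE_def extensional_restrict)
  qed
  then show ?thesis by blast
qed

end

theory Submission
  imports Defs
begin

text \<open>
  Say \<open>x \<in> G1 - G2\<close>. Take a column whose \<open>+1\<close>-set \<open>A\<close> misses \<open>x\<close>, meets \<open>G1\<close> in exactly
  \<open>\<lfloor>|G1| / 2\<rfloor>\<close> stations and contains some \<open>y \<notin> G1\<close>. Exchanging \<open>y\<close> for \<open>x\<close> turns the bit of
  \<open>G1\<close> from 0 to 1, whereas \<open>|A \<inter> G2|\<close> does not increase, so the bit of \<open>G2\<close> cannot turn
  from 0 to 1. Hence the two bitstreams differ in one of these two columns.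
\<close>

lemma finite_stations [simp]: "finite (stations N)"
  and card_stations [simp]: "card (stations N) = N"
  by (simp_all add: stations_def)

text \<open>Against the baseline of -1 per station of \<open>G\<close>, each station also in
  \<open>A\<close> contributes an extra 2.\<close>

lemma sum_signs:
  assumes "finite G"
  shows "(\<Sum>r\<in>G. if r \<in> A then 1 else (-1::int)) = 2 * int (card (A \<inter> G)) - int (card G)"
  using assms by (induction G rule: finite_induct) (auto simp: Int_insert_right)

text \<open>Surjectivity of the column map, with columns addressed by their +1-set \<open>A\<close>;
  oddness of \<open>N\<close> gives the complement of \<open>A\<close> the required size.\<close>

lemma coefficient_matrix_column:
  assumes M: "coefficient_matrix N M" and N: "odd N"
    and A: "A \<subseteq> stations N" "card A = plus_count N"
  obtains c where "c \<in> col_indices N"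
    and "\<And>r. r \<in> stations N \<Longrightarrow> M r c = (if r \<in> A then 1 else -1)"
proof -
  let ?v = "\<lambda>r\<in>stations N. if r \<in> A then 1 else (-1::int)"
  have "{r \<in> stations N. ?v r = 1} = A"
    using A(1) by (auto split: if_splits)
  moreover have "{r \<in> stations N. ?v r = -1} = stations N - A"
    by (auto split: if_splits)
  moreover have "card (stations N - A) = plus_count N - 1"
    using A N by (auto simp: card_Diff_subset finite_subset plus_count_def elim!: oddE)
  ultimately have "?v \<in> balanced_vectors N"
    using A(2) unfolding balanced_vectors_def by auto
  then obtain c where c: "c \<in> col_indices N" "(\<lambda>r\<in>stations N. M r c) = ?v"
    using M unfolding coefficient_matrix_def bij_betw_def by (metis (no_types, lifting) imageE)
  show thesis
  proof (rule that[OF c(1)])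
    fix r assume "r \<in> stations N"
    then show "M r c = (if r \<in> A then 1 else -1)"
      using fun_cong[OF c(2), of r] by simp
  qed
qed

text \<open>Turns equal bitstreams into pure counting: the bit of a set is 1 exactly when
  \<open>A\<close> holds more than half of it.\<close>

lemma decoded_eq_majority:
  assumes eq: "decoded N M G1 = decoded N M G2"
    and M: "coefficient_matrix N M" and N: "odd N"
    and G: "G1 \<subseteq> stations N" "G2 \<subseteq> stations N"
    and A: "A \<subseteq> stations N" "card A = plus_count N"
  shows "card G1 < 2 * card (A \<inter> G1) \<longleftrightarrow> card G2 < 2 * card (A \<inter> G2)"
proof -
  obtain c where c: "c \<in> col_indices N"
    and col: "\<And>r. r \<in> stations N \<Longrightarrow> M r c = (if r \<in> A then 1 else -1)"
    using coefficient_matrix_column[OF M N A] by blast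
  have sup: "superposition M H c = 2 * int (card (A \<inter> H)) - int (card H)"
    if "H \<subseteq> stations N" for H
  proof -
    have "superposition M H c = (\<Sum>r\<in>H. if r \<in> A then 1 else -1)"
      unfolding superposition_def using that col by (intro sum.cong) auto
    then show ?thesis
      using sum_signs[of H A] finite_subset[OF that] by simp
  qed
  have "superposition M G1 c \<ge> 1 \<longleftrightarrow> superposition M G2 c \<ge> 1"
    using fun_cong[OF eq, of c] c by (auto simp: decoded_def split: if_splits)
  then show ?thesis
    unfolding sup[OF G(1)] sup[OF G(2)] by linarith
qed

lemma decoded_eq_imp_subset:
  assumes eq: "decoded N M G1 = decoded N M G2"
    and M: "coefficient_matrix N M" and N: "odd N"
    and G1: "G1 \<subset> stations N" and G2: "G2 \<subseteq> stations N"
  shows "G1 \<subseteq> G2"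
proof (rule ccontr)
  assume "\<not> G1 \<subseteq> G2"
  then obtain x where x: "x \<in> G1" "x \<notin> G2" by blast
  have fin: "finite G1" "finite G2"
    using G1 G2 by (auto intro: finite_subset[OF _ finite_stations])
  \<comment> \<open>The threshold: \<open>h\<close> stations of \<open>G1\<close> in the +1-set give
    bit 0, \<open>Suc h\<close> give bit 1.\<close>
  define h where "h = card G1 div 2"
  have pos: "card G1 > 0" using fin(1) x(1) by (auto simp: card_gt_0_iff)
  have less: "card G1 < N" using psubset_card_mono[OF finite_stations G1] by simp
  \<comment> \<open>This \<open>R\<close> is one less than the number of +1 entries in a
    column.\<close>
  obtain R where R: "plus_count N = Suc R" "N = Suc (2 * R)"
    using N by (auto simp: plus_count_def elim!: oddE)
  have "h \<le> card (G1 - {x})" using pos x(1) fin(1) by (simp add: h_def)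
  then obtain B where B: "B \<subseteq> G1 - {x}" "card B = h" "finite B"
    by (rule obtain_subset_with_card_n)
  have "card (stations N - G1) = N - card G1"
    using G1 fin(1) by (simp add: card_Diff_subset psubset_imp_subset)
  \<comment> \<open>Properness of \<open>G1\<close> gives \<open>card G1\<close> \<le>
    \<open>2 * R\<close>, which leaves enough stations outside \<open>G1\<close> to fill a +1-set up
    to \<open>Suc R\<close>.\<close>
  then have "R - h \<le> card (stations N - G1) - 1" "card (stations N - G1) > 0" "h \<le> R"
    using less R by (auto simp: h_def)
  then have "Suc R - h \<le> card (stations N - G1)" by linarith
  then obtain C where C: "C \<subseteq> stations N - G1" "card C = Suc R - h" "finite C"
    by (rule obtain_subset_with_card_n)
  have "C \<noteq> {}" using C(2) \<open>h \<le> R\<close> by auto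
  then obtain y where y: "y \<in> C" by blast
  define A where "A = B \<union> C"
  define A' where "A' = insert x (A - {y})"
  have BC: "B \<inter> C = {}" using B(1) C(1) by blast
  have finA: "finite A" using B(3) C(3) by (simp add: A_def)
  have cardA: "card A = Suc R"
    using B C BC \<open>h \<le> R\<close> by (simp add: A_def card_Un_disjoint)
  have xy: "x \<notin> A" "y \<in> A" "y \<notin> G1" using B(1) C(1) x y by (auto simp: A_def)
  have cardA': "card A' = Suc R"
    using xy finA cardA by (simp add: A'_def card_Diff_singleton)
  have sub: "A \<subseteq> stations N" "A' \<subseteq> stations N"
    using B(1) C(1) G1 x by (auto simp: A_def A'_def)
  have AG1: "A \<inter> G1 = B" using B(1) C(1) by (auto simp: A_def)
  have A'G1: "A' \<inter> G1 = insert x B" using AG1 xy x by (auto simp: A'_def)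
  have "card (A' \<inter> G1) = Suc h" using A'G1 B by (auto simp: card_insert_if)
  then have 1: "card G1 < 2 * card (A' \<inter> G1)" "\<not> card G1 < 2 * card (A \<inter> G1)"
    using AG1 B(2) by (auto simp: h_def)
  \<comment> \<open>The station gained, \<open>x\<close>, lies outside \<open>G2\<close>.\<close>
  have "A' \<inter> G2 \<subseteq> A \<inter> G2" using x by (auto simp: A'_def)
  then have 2: "card (A' \<inter> G2) \<le> card (A \<inter> G2)"
    using fin(2) by (intro card_mono) auto
  note maj = decoded_eq_majority[OF eq M N psubset_imp_subset[OF G1] G2]
  \<comment> \<open>A majority of \<open>A'\<close> in \<open>G1\<close> passes to
    \<open>G2\<close>, then by 2 to \<open>A\<close> in \<open>G2\<close>, and back to
    \<open>A\<close> in \<open>G1\<close>, against 1.\<close>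
  show False
    using maj[OF sub(1)] maj[OF sub(2)] cardA cardA' R(1) 1 2 by simp
qed

theorem proposition1:
  fixes N :: nat and M :: "nat \<Rightarrow> nat \<Rightarrow> int" and G1 G2 :: "nat set"
  assumes "N \<ge> 1" and "odd N"
    and "coefficient_matrix N M"
    and "G1 \<noteq> {}" and "G1 \<subset> stations N"
    and "G2 \<noteq> {}" and "G2 \<subset> stations N"
  shows "decoded N M G1 = decoded N M G2 \<longleftrightarrow> G1 = G2"
proof
  assume eq: "decoded N M G1 = decoded N M G2"
  \<comment> \<open>The hypotheses are symmetric in the two sets, so both inclusions follow.\<close>
  show "G1 = G2"
    using decoded_eq_imp_subset[OF eq assms(3,2,5)] decoded_eq_imp_subset[OF eq[symmetric] assms(3,2,7)]
      assms(5,7) by blast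
qed simp

end
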